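(* Let $1\le k\le n$, let $x_1,\dots,x_n,y$ be propositional variables and let $p_{ij}$ ($1\le i\le k$, $1\le j\le n-k+1$) be fresh propositional variables. The CNF formula consisting of the conjunction of $$\bigwedge_{1\le i\le k}\Big(\neg y\vee\bigvee_{1\le j\le n-k+1}p_{ij}\Big),$$ $$\bigwedge_{1\le i\le k}\ \bigwedge_{1\le j\le n-k+1}(x_{i+j-1}\vee\neg p_{ij}),$$ $$\bigwedge_{1\le i<k}\ \bigwedge_{1\le j<n-k+1}\Big(\neg p_{(i+1)j}\vee\bigvee_{1\le l\le j}p_{il}\Big)$$ preserves the generalized arc consistency (by unit propagation) of $y\rightarrow\sum_{i=1}^n x_i\ge k$.
   Context: Unit propagation on a CNF formula repeatedly picks a unit clause $\{l\}$, deletes all clauses containing $l$ and removes the complement of $l$ from the other clauses; a literal is derived by unit propagation if it occurs as a unit clause at some stage, and a conflict is derived if the empty clause appears. For a set of literals $\rho$, unit propagation on $\mathcal F$ under $\rho$ means unit propagation on $\mathcal F\wedge\bigwedge_{l\in\rho}l$. A partial assignment of $x_1,\dots,x_n$ is a set of literals over these variables containing no complementary pair. A CNF formula $\mathcal F$ over $y,x_1,\dots,x_n$ and auxiliary variables preserves the generalized arc consistency (GAC) of $y\rightarrow\sum_{i=1}^n x_i\ge k$ if for every partial assignment $\rho$ of $x_1,\dots,x_n$: (i) (when $y$ is true, GAC is maintained on the cardinality constraint) under $\rho\cup\{y\}$: if more than $n-k$ of the $x_i$ are false in $\rho$, unit propagation on $\mathcal F$ derives a conflict; and if exactly $n-k$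 of the $x_i$ are false in $\rho$, unit propagation derives $x_j$ for every $x_j$ not assigned by $\rho$; (ii) if more than $n-k$ of the $x_i$ are false in $\rho$ (the cardinality constraint is false), unit propagation on $\mathcal F$ under $\rho$ derives $\neg y$. *)

theory Defs
  imports Main
begin

datatype 'v lit = Pos 'v | Neg 'v

fun complement :: "'v lit \<Rightarrow> 'v lit" where
  "complement (Pos v) = Neg v"
| "complement (Neg v) = Pos v"

type_synonym 'v clause = "'v lit set"
type_synonym 'v cnf = "'v clause set"

text \<open>
  One propagation step removes every clause containing \<open>l\<close>, hence also the unit clause
  \<open>{l}\<close> itself, so each literal is propagated at most once.
\<close>

inductive up_step :: "'v cnf \<Rightarrow> 'v cnf \<Rightarrow> bool" where
  "{l} \<in> F \<Longrightarrow> up_step F ((\<lambda>C. C - {complement l}) ` {C \<in> F. l \<notin> C})"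

text \<open>
  The formulas reachable from \<open>F\<close> by \<open>up_step\<close> are the stages of unit propagation on
  \<open>F\<close>; the stage witnessing a derivation may be reached by any order of picking units.
\<close>

definition up_derives :: "'v cnf \<Rightarrow> 'v lit \<Rightarrow> bool" where
  "up_derives F l \<longleftrightarrow> (\<exists>G. up_step\<^sup>*\<^sup>* F G \<and> {l} \<in> G)"

definition up_conflict :: "'v cnf \<Rightarrow> bool" where
  "up_conflict F \<longleftrightarrow> (\<exists>G. up_step\<^sup>*\<^sup>* F G \<and> {} \<in> G)"

definition under :: "'v cnf \<Rightarrow> 'v lit set \<Rightarrow> 'v cnf" where
  "under F \<rho> = F \<union> {{l} | l. l \<in> \<rho>}"

definition partial_assignment :: "'v set \<Rightarrow> 'v lit set \<Rightarrow> bool" where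
  "partial_assignment V \<rho> \<longleftrightarrow>
     \<rho> \<subseteq> Pos ` V \<union> Neg ` V \<and> (\<forall>l \<in> \<rho>. complement l \<notin> \<rho>)"

definition num_false :: "(nat \<Rightarrow> 'v) \<Rightarrow> nat \<Rightarrow> 'v lit set \<Rightarrow> nat" where
  "num_false x n \<rho> = card {i \<in> {1..n}. Neg (x i) \<in> \<rho>}"

text \<open>
  Generalized arc consistency of \<open>y \<longrightarrow> x 1 + \<dots> + x n \<ge> k\<close>.
  Comparisons of the number of false variables with \<open>n - k\<close> are written additively
  because subtraction on \<^typ>\<open>nat\<close> truncates.
\<close>

definition preserves_gac ::
  "'v cnf \<Rightarrow> 'v \<Rightarrow> (nat \<Rightarrow> 'v) \<Rightarrow> nat \<Rightarrow> nat \<Rightarrow> bool" where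
  "preserves_gac F y x n k \<longleftrightarrow>
     (\<forall>\<rho>. partial_assignment (x ` {1..n}) \<rho> \<longrightarrow>
        (num_false x n \<rho> + k > n \<longrightarrow> up_conflict (under F (\<rho> \<union> {Pos y}))) \<and>
        (num_false x n \<rho> + k = n \<longrightarrow>
           (\<forall>j \<in> {1..n}. Pos (x j) \<notin> \<rho> \<and> Neg (x j) \<notin> \<rho> \<longrightarrow>
              up_derives (under F (\<rho> \<union> {Pos y})) (Pos (x j)))) \<and>
        (num_false x n \<rho> + k > n \<longrightarrow> up_derives (under F \<rho>) (Neg y)))"

definition card_encoding ::
  "'v \<Rightarrow> (nat \<Rightarrow> 'v) \<Rightarrow> (nat \<Rightarrow> nat \<Rightarrow> 'v) \<Rightarrow> nat \<Rightarrow> nat \<Rightarrow> 'v cnf" where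
  "card_encoding y x p n k =
     {{Neg y} \<union> {Pos (p i j) | j. 1 \<le> j \<and> j \<le> n - k + 1} | i. 1 \<le> i \<and> i \<le> k}
   \<union> {{Pos (x (i + j - 1)), Neg (p i j)} | i j.
        1 \<le> i \<and> i \<le> k \<and> 1 \<le> j \<and> j \<le> n - k + 1}
   \<union> {{Neg (p (i + 1) j)} \<union> {Pos (p i l) | l. 1 \<le> l \<and> l \<le> j} | i j.
        1 \<le> i \<and> i < k \<and> 1 \<le> j \<and> j < n - k + 1}"

end

theory Submission
  imports Defs
begin

text \<open>
  Let \<open>c t\<close> be the number of non-false variables among \<open>x\<^sub>1, \<dots>, x\<^sub>t\<close>. The intended meaning of
  \<open>p\<^sub>i\<^sub>j\<close> is that \<open>x\<^bsub>i+j-1\<^esub>\<close> is the \<open>i\<close>-th non-false variable. Propagating the clauses of the second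
  and third kind row by row makes \<open>p\<^sub>i\<^sub>j\<close> false whenever \<open>c (i + j - 1) < i\<close>. If \<open>c n < k\<close>, this
  falsifies a whole row, so \<open>\<not> y\<close> follows. If \<open>c n = k\<close>, the rows are completed from the last one
  upwards: in each row \<open>i\<close> the only variable that remains is the one placed at the \<open>i\<close>-th non-false
  \<open>x\<close>, so it is propagated, and with it that \<open>x\<close>. The order in which units are picked matters only
  if a conflict arises, which is excluded by exhibiting a model where needed.
\<close>

section \<open>Unit propagation as a closure\<close>

lemma complement_complement [simp]: "complement (complement l) = l"
  by (cases l) auto

lemma complement_neq [simp]: "complement l \<noteq> l"
  by (cases l) auto

text \<open>Each \<open>up_step\<close> rewrites the whole formula, which makes derivations hard to
  combine; this closure refers to the fixed \<open>F\<close> only. Finiteness of \<open>C\<close>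
  lets its other literals be propagated one at a time.\<close>

inductive implied :: "'v cnf \<Rightarrow> 'v lit \<Rightarrow> bool" for F where
  impliedI: "\<lbrakk>C \<in> F; finite C; l \<in> C; \<And>l'. l' \<in> C - {l} \<Longrightarrow> implied F (complement l')\<rbrakk>
    \<Longrightarrow> implied F l"

text \<open>The stage left once the units in \<open>S\<close> have been picked, which depends on the
  set \<open>S\<close> and not on the order.\<close>

definition residual :: "'v cnf \<Rightarrow> 'v lit set \<Rightarrow> 'v cnf" where
  "residual F S = (\<lambda>C. C - complement ` S) ` {C \<in> F. C \<inter> S = {}}"

text \<open>The units in \<open>S\<close> are gone from the residual, so that they were derived is
  recorded separately.\<close>

definition propagated :: "'v cnf \<Rightarrow> 'v lit set \<Rightarrow> bool" where
  "propagated F S \<longleftrightarrow> up_step\<^sup>*\<^sup>* F (residual F S) \<and> (\<forall>l \<in> S. complement l \<notin> S) \<and>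
     (\<forall>l \<in> S. up_derives F l)"

lemma propagated_empty: "propagated F {}"
  by (simp add: propagated_def residual_def)

lemma up_step_residual:
  assumes "{l} \<in> residual F S"
  shows "up_step (residual F S) (residual F (insert l S))"
proof -
  have l: "l \<notin> complement ` S"
    using assms by (auto simp: residual_def)
  have "(\<lambda>C. C - {complement l}) ` {C \<in> residual F S. l \<notin> C} = residual F (insert l S)"
  proof -
    have "{C \<in> residual F S. l \<notin> C} = (\<lambda>C. C - complement ` S) ` {C \<in> F. C \<inter> insert l S = {}}"
      using l unfolding residual_def by blast
    moreover have "C - complement ` S - {complement l} = C - complement ` insert l S" for C
      by blast
    ultimately show ?thesis
      by (simp add: residual_def image_image)
  qed
  then show ?thesis
    using up_step.intros[OF assms] by simp
qed

text \<open>If \<open>l\<close> is new, \<open>C\<close> has shrunk to \<open>{l}\<close> or to the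
  empty clause, and the latter is a conflict.\<close>

lemma propagated_insert:
  assumes S: "propagated F S" and C: "C \<in> F" "l \<in> C" "complement ` (C - {l}) \<subseteq> S"
    and no: "\<not> up_conflict F"
  shows "propagated F (insert l S)"
proof (cases "l \<in> S")
  case True
  then show ?thesis using S by (simp add: insert_absorb)
next
  case False
  have reach: "up_step\<^sup>*\<^sup>* F (residual F S)" and cons: "\<And>l. l \<in> S \<Longrightarrow> complement l \<notin> S"
    using S by (auto simp: propagated_def)
  have disj: "C \<inter> S = {}"
    using C cons False by blast
  then have mem: "C - complement ` S \<in> residual F S"
    using C by (auto simp: residual_def)
  have rest: "C - {l} \<subseteq> complement ` S"
    using C(3) by (force simp: image_iff)
  have "l \<notin> complement ` S"
  proof
    assume "l \<in> complement ` S"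
    then have "C - complement ` S = {}" using rest by auto
    then have "{} \<in> residual F S" using mem by (simp only:)
    then show False using reach no by (auto simp: up_conflict_def)
  qed
  then have "C - complement ` S = {l}"
    using rest C(2) by auto
  then have unit: "{l} \<in> residual F S" using mem by (simp only:)
  have "up_step\<^sup>*\<^sup>* F (residual F (insert l S))"
    using reach up_step_residual[OF unit] by (rule rtranclp.rtrancl_into_rtrancl)
  moreover have "complement l \<notin> S"
    using \<open>l \<notin> complement ` S\<close> by (metis complement_complement imageI)
  then have "\<forall>a \<in> insert l S. complement a \<notin> insert l S"
    using cons by (metis complement_complement complement_neq insert_iff)
  moreover have "\<forall>a \<in> insert l S. up_derives F a"
    using S reach unit by (auto simp: propagated_def up_derives_def)
  ultimately show ?thesis
    by (simp only: propagated_def)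
qed

lemma propagated_extend_set:
  assumes "finite A" "propagated F S"
    and "\<And>l S. l \<in> A \<Longrightarrow> propagated F S \<Longrightarrow> \<exists>T. S \<subseteq> T \<and> l \<in> T \<and> propagated F T"
  shows "\<exists>T. S \<subseteq> T \<and> A \<subseteq> T \<and> propagated F T"
  using assms
proof (induction A arbitrary: S rule: finite_induct)
  case empty
  then show ?case by blast
next
  case (insert a A)
  obtain T where T: "S \<subseteq> T" "A \<subseteq> T" "propagated F T"
    using insert.IH[OF insert.prems(1)] insert.prems(2) by blast
  then obtain T' where "T \<subseteq> T'" "a \<in> T'" "propagated F T'"
    using insert.prems(2)[of a T] by auto
  then show ?case using T by blast
qed

text \<open>Starting from an arbitrary \<open>S\<close> lets the premises of a rule be propagated in
  succession, each on top of the previous ones.\<close>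

lemma implied_extend:
  assumes "implied F l" "propagated F S" "\<not> up_conflict F"
  shows "\<exists>T. S \<subseteq> T \<and> l \<in> T \<and> propagated F T"
  using assms
proof (induction arbitrary: S rule: implied.induct)
  case (impliedI C l)
  have "\<exists>T. S \<subseteq> T \<and> complement ` (C - {l}) \<subseteq> T \<and> propagated F T"
  proof (rule propagated_extend_set)
    show "finite (complement ` (C - {l}))" using impliedI.hyps by simp
  qed (use impliedI in auto)
  then obtain T where "S \<subseteq> T" "complement ` (C - {l}) \<subseteq> T" "propagated F T" by blast
  then show ?case
    using propagated_insert[of F T C l] impliedI.hyps impliedI.prems by blast
qed

lemma implied_up_derives:
  assumes "implied F l" "\<not> up_conflict F"
  shows "up_derives F l"
  using implied_extend[OF assms(1) propagated_empty assms(2)]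
  by (auto simp: propagated_def)

text \<open>Without a conflict, the complements of all literals of \<open>C\<close> could be
  propagated together. Consistency keeps \<open>C\<close> from being deleted, so it would shrink to
  the empty clause.\<close>

lemma implied_up_conflict:
  assumes "C \<in> F" "finite C" and imp: "\<And>l. l \<in> C \<Longrightarrow> implied F (complement l)"
  shows "up_conflict F"
proof (rule ccontr)
  assume no: "\<not> up_conflict F"
  have "\<exists>T. {} \<subseteq> T \<and> complement ` C \<subseteq> T \<and> propagated F T"
  proof (rule propagated_extend_set)
    show "finite (complement ` C)" using assms by simp
    show "propagated F {}" by (rule propagated_empty)
  qed (use imp no implied_extend in blast)
  then obtain T where T: "complement ` C \<subseteq> T" "propagated F T" by blast
  have "C \<subseteq> complement ` T"
    using T(1) by (force simp: image_iff)
  moreover have "C \<inter> T = {}"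
    using T by (auto simp: propagated_def)
  ultimately have "{} \<in> residual F T"
    using assms(1) unfolding residual_def by blast
  then show False
    using T(2) no by (auto simp: propagated_def up_conflict_def)
qed

section \<open>Satisfiable formulas have no conflict\<close>

fun holds :: "('v \<Rightarrow> bool) \<Rightarrow> 'v lit \<Rightarrow> bool" where
  "holds v (Pos a) \<longleftrightarrow> v a"
| "holds v (Neg a) \<longleftrightarrow> \<not> v a"

lemma holds_complement [simp]: "holds v (complement l) \<longleftrightarrow> \<not> holds v l"
  by (cases l) auto

definition satisfies :: "('v \<Rightarrow> bool) \<Rightarrow> 'v cnf \<Rightarrow> bool" where
  "satisfies v F \<longleftrightarrow> (\<forall>C \<in> F. \<exists>l \<in> C. holds v l)"

text \<open>The unit \<open>l\<close> holds in the model, so only a false literal is removed from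
  clauses.\<close>

lemma satisfies_up_step:
  assumes "up_step F G" "satisfies v F"
  shows "satisfies v G"
  using assms(1)
proof cases
  case (1 l)
  have "holds v l" using assms(2) 1(2) by (auto simp: satisfies_def)
  then have "l' \<noteq> complement l" if "holds v l'" for l'
    using that by auto
  then show ?thesis
    using assms(2) unfolding 1(1) satisfies_def by blast
qed

lemma satisfies_no_conflict:
  assumes "satisfies v F"
  shows "\<not> up_conflict F"
proof -
  have "satisfies v G" if "up_step\<^sup>*\<^sup>* F G" for G
    using that by induction (use assms satisfies_up_step in auto)
  then show ?thesis
    by (auto simp: up_conflict_def satisfies_def)
qed

section \<open>Propagation in the cardinality encoding\<close>

text \<open>\<open>N\<close> stands for the indices of the non-false variables. \<open>F\<close> may
  have further clauses, so that the lemmas apply with and without the unit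
  \<open>{Pos y}\<close>.\<close>

locale card_propagation =
  fixes y :: 'v and x :: "nat \<Rightarrow> 'v" and p :: "nat \<Rightarrow> nat \<Rightarrow> 'v" and n k :: nat
    and N :: "nat set" and F :: "'v cnf"
  assumes k_pos: "1 \<le> k" and k_le: "k \<le> n"
    and encoding: "card_encoding y x p n k \<subseteq> F"
    and false_unit: "\<And>t. \<lbrakk>1 \<le> t; t \<le> n; t \<notin> N\<rbrakk> \<Longrightarrow> {Neg (x t)} \<in> F"
begin

section \<open>Counting non-false variables\<close>

definition cnt :: "nat \<Rightarrow> nat" where
  "cnt t = card (N \<inter> {1..t})"

lemma cnt_0 [simp]: "cnt 0 = 0"
  by (simp add: cnt_def)

lemma cnt_Suc: "cnt (Suc t) = (if Suc t \<in> N then Suc (cnt t) else cnt t)"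
  by (simp add: cnt_def atLeastAtMostSuc_conv Int_insert_right)

lemma cnt_le_add: "cnt (s + d) \<le> cnt s + d"
  by (induction d) (auto simp: cnt_Suc)

lemma cnt_le: "cnt t \<le> t"
  using cnt_le_add[of 0 t] by simp

lemma cnt_mono: "s \<le> t \<Longrightarrow> cnt s \<le> cnt t"
  by (rule lift_Suc_mono_le[of cnt]) (auto simp: cnt_Suc)

lemma cnt_less:
  assumes "s < t" "t \<in> N"
  shows "cnt s < cnt t"
proof (cases t)
  case (Suc u)
  then show ?thesis using assms cnt_mono[of s u] by (simp add: cnt_Suc)
qed (use assms in simp)

lemma cnt_inj:
  assumes "cnt s = cnt t" "s \<in> N" "t \<in> N"
  shows "s = t"
  using assms cnt_less[of s t] cnt_less[of t s] by (cases s t rule: linorder_cases) auto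

text \<open>\<open>cnt\<close> grows by at most one per index, so it attains \<open>i\<close>, and
  does so first at an element of \<open>N\<close>.\<close>

lemma cnt_witness:
  assumes "1 \<le> i" "i \<le> cnt t"
  shows "\<exists>s. 1 \<le> s \<and> s \<le> t \<and> s \<in> N \<and> cnt s = i"
  using assms
proof (induction t)
  case (Suc t)
  show ?case
  proof (cases "i \<le> cnt t")
    case True
    then show ?thesis using Suc by fastforce
  next
    case False
    then have "Suc t \<in> N \<and> cnt (Suc t) = i"
      using Suc.prems by (auto simp: cnt_Suc split: if_splits)
    then show ?thesis by auto
  qed
qed simp

text \<open>The \<open>i\<close>-th non-false variable has at least \<open>i - 1\<close> positions
  before it and \<open>k - i\<close> after it, so its position \<open>s\<close> satisfies
  \<open>i <= s <= n - k + i\<close>, the range covered by row \<open>i\<close>.\<close>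

lemma cnt_witness_row:
  assumes "1 \<le> i" "i \<le> k" "cnt n = k"
  obtains j where "1 \<le> j" "j \<le> n - k + 1" "i + j - 1 \<in> N" "cnt (i + j - 1) = i"
proof -
  obtain s where s: "1 \<le> s" "s \<le> n" "s \<in> N" "cnt s = i"
    using cnt_witness[of i n] assms by auto
  have "i \<le> s" using cnt_le[of s] s by simp
  moreover have "k \<le> i + (n - s)"
    using cnt_le_add[of s "n - s"] s assms by simp
  ultimately show thesis
    using s by (intro that[of "s - i + 1"]) auto
qed

section \<open>Falsifying cells row by row\<close>

lemma row_clause:
  assumes "1 \<le> i" "i \<le> k"
  shows "{Neg y} \<union> {Pos (p i j) | j. 1 \<le> j \<and> j \<le> n - k + 1} \<in> F"
  by (rule subsetD[OF encoding], unfold card_encoding_def, intro UnI1 CollectI exI[of _ i] conjI refl assms)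

lemma cell_clause:
  assumes "1 \<le> i" "i \<le> k" "1 \<le> j" "j \<le> n - k + 1"
  shows "{Pos (x (i + j - 1)), Neg (p i j)} \<in> F"
  by (rule subsetD[OF encoding], unfold card_encoding_def, rule UnI1[OF UnI2], rule CollectI,
      rule exI[of _ i], rule exI[of _ j], intro conjI refl assms)

lemma step_clause:
  assumes "1 \<le> i" "i < k" "1 \<le> j" "j < n - k + 1"
  shows "{Neg (p (i + 1) j)} \<union> {Pos (p i l) | l. 1 \<le> l \<and> l \<le> j} \<in> F"
  by (rule subsetD[OF encoding], unfold card_encoding_def, rule UnI2, rule CollectI,
      rule exI[of _ i], rule exI[of _ j], intro conjI refl assms)

lemma implied_unit:
  assumes "{l} \<in> F"
  shows "implied F l"
  by (rule impliedI[OF assms]) auto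

lemma implied_cell_false:
  assumes "1 \<le> i" "i \<le> k" "1 \<le> j" "j \<le> n - k + 1" "i + j - 1 \<notin> N"
  shows "implied F (Neg (p i j))"
proof (rule impliedI[OF cell_clause[OF assms(1-4)]])
  have "implied F (Neg (x (i + j - 1)))"
    using assms k_le by (intro implied_unit false_unit) auto
  then show "implied F (complement l)"
    if "l \<in> {Pos (x (i + j - 1)), Neg (p i j)} - {Neg (p i j)}" for l
    using that by auto
qed auto

lemma implied_cell_pos:
  assumes "1 \<le> i" "i \<le> k" "1 \<le> j" "j \<le> n - k + 1" "implied F (Pos (p i j))"
  shows "implied F (Pos (x (i + j - 1)))"
  by (rule impliedI[OF cell_clause[OF assms(1-4)]]) (use assms(5) in auto)

text \<open>
  The bound on \<open>cnt (i' + (n - k))\<close> says that no earlier row is falsified completely; such a row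
  could not be carried over to the next one, as there is no third clause for \<open>j = n - k + 1\<close>.
\<close>

lemma implied_prefix_false:
  assumes "1 \<le> i" "i \<le> k" "1 \<le> j" "j \<le> n - k + 1" "cnt (i + j - 1) < i"
    and "\<And>i'. \<lbrakk>1 \<le> i'; i' < i\<rbrakk> \<Longrightarrow> i' \<le> cnt (i' + (n - k))"
  shows "implied F (Neg (p i j))"
  using assms
proof (induction i arbitrary: j rule: nat_induct_at_least)
  case base
  then have "j \<notin> N" using cnt_less[of 0 j] by auto
  then show ?case using base by (intro implied_cell_false) auto
next
  case (Suc i)
  show ?case
  proof (cases "i + j \<in> N")
    case False
    then show ?thesis using Suc by (intro implied_cell_false) auto
  next
    case True
    then have less: "cnt (i + j - 1) < i"
      using cnt_less[of "i + j - 1" "i + j"] Suc by simp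
    moreover have "i \<le> cnt (i + (n - k))"
      using Suc.prems(5) Suc.hyps by simp
    ultimately have "j \<noteq> n - k + 1" by auto
    then have j: "j < n - k + 1" using Suc.prems(3) by simp
    have row: "implied F (Neg (p i l))" if "1 \<le> l" "l \<le> j" for l
    proof (rule Suc.IH)
      have "i + l - 1 \<le> i + j - 1" using that by simp
      then show "cnt (i + l - 1) < i"
        using cnt_mono less by (blast intro: le_less_trans)
    qed (use that Suc.prems in auto)
    have "{Neg (p (i + 1) j)} \<union> {Pos (p i l) | l. 1 \<le> l \<and> l \<le> j} \<in> F"
      using Suc j by (intro step_clause) auto
    then show ?thesis
      by (rule impliedI) (use row in auto)
  qed
qed

lemma implied_row_false:
  assumes "cnt n < k"
  obtains i where "1 \<le> i" "i \<le> k"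
    "\<And>j. \<lbrakk>1 \<le> j; j \<le> n - k + 1\<rbrakk> \<Longrightarrow> implied F (Neg (p i j))"
proof -
  \<comment> \<open>Row \<open>i\<close> ends at position \<open>i + (n - k)\<close>. Minimality of
    the chosen row yields the side condition on earlier rows; row \<open>k\<close> qualifies because
    it ends at \<open>n\<close>.\<close>
  define P where "P i \<longleftrightarrow> 1 \<le> i \<and> cnt (i + (n - k)) < i" for i
  define i where "i = (LEAST i. P i)"
  have "P k" using assms k_pos k_le by (simp add: P_def)
  then have i: "P i" "i \<le> k"
    unfolding i_def by (auto intro: LeastI Least_le)
  have less: "i' \<le> cnt (i' + (n - k))" if "1 \<le> i'" "i' < i" for i'
    using not_less_Least[of i' P] that by (auto simp: i_def P_def)
  show thesis
  proof (rule that[of i])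
    fix j assume j: "1 \<le> j" "j \<le> n - k + 1"
    then have "i + j - 1 \<le> i + (n - k)" by simp
    then have "cnt (i + j - 1) < i"
      using cnt_mono i(1) by (auto simp: P_def intro: le_less_trans)
    then show "implied F (Neg (p i j))"
      using i j less by (intro implied_prefix_false) (auto simp: P_def)
  qed (use i in \<open>auto simp: P_def\<close>)
qed

lemma implied_not_y:
  assumes "cnt n < k"
  shows "implied F (Neg y)"
proof -
  obtain i where i: "1 \<le> i" "i \<le> k"
    "\<And>j. \<lbrakk>1 \<le> j; j \<le> n - k + 1\<rbrakk> \<Longrightarrow> implied F (Neg (p i j))"
    using implied_row_false[OF assms] by blast
  show ?thesis
    by (rule impliedI[OF row_clause[OF i(1,2)]]) (use i in auto)
qed

lemma conflict_if_y:
  assumes "cnt n < k" "{Pos y} \<in> F"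
  shows "up_conflict F"
  by (rule implied_up_conflict[OF assms(2)]) (use implied_not_y[OF assms(1)] in auto)

section \<open>Exactly \<open>k\<close> non-false variables\<close>

text \<open>A count below \<open>i\<close> falls under the prefix lemma. A count equal to
  \<open>i\<close> away from the \<open>i\<close>-th non-false position means a false variable
  there, since counts are distinct on \<open>N\<close>.\<close>

lemma implied_other_cells_false:
  assumes "cnt n = k" "1 \<le> i" "i \<le> k" "1 \<le> l" "l \<le> n - k + 1" "l \<noteq> j"
    and "i + j - 1 \<in> N" "cnt (i + j - 1) = i" "cnt (i + l - 1) \<le> i"
  shows "implied F (Neg (p i l))"
proof (cases "cnt (i + l - 1) < i")
  case True
  \<comment> \<open>Only \<open>k - i'\<close> positions follow \<open>i' + (n - k)\<close>, so at
    least \<open>i'\<close> of the \<open>k\<close> non-false variables occur up to it.\<close>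
  have "i' \<le> cnt (i' + (n - k))" if "i' < i" for i'
    using cnt_le_add[of "i' + (n - k)" "k - i'"] that assms(1,3) k_le by simp
  then show ?thesis
    using True assms by (intro implied_prefix_false) auto
next
  case False
  then have "cnt (i + l - 1) = cnt (i + j - 1)" "i + l - 1 \<noteq> i + j - 1"
    using assms by auto
  then have "i + l - 1 \<notin> N" using cnt_inj assms by blast
  then show ?thesis using assms by (intro implied_cell_false) auto
qed

lemma implied_row_true:
  assumes "{Pos y} \<in> F" "1 \<le> i" "i \<le> k" "1 \<le> j" "j \<le> n - k + 1"
    and "\<And>l. \<lbrakk>1 \<le> l; l \<le> n - k + 1; l \<noteq> j\<rbrakk> \<Longrightarrow> implied F (Neg (p i l))"
  shows "implied F (Pos (p i j))"
proof (rule impliedI[OF row_clause[OF assms(2,3)]])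
  fix l' assume "l' \<in> {Neg y} \<union> {Pos (p i l) | l. 1 \<le> l \<and> l \<le> n - k + 1} - {Pos (p i j)}"
  then consider "l' = Neg y" | l where "l' = Pos (p i l)" "1 \<le> l" "l \<le> n - k + 1" "l \<noteq> j"
    by blast
  then show "implied F (complement l')"
    by cases (use assms(6) implied_unit[OF assms(1)] in auto)
qed (use assms(4,5) in auto)

text \<open>Downward induction from row \<open>k\<close>, whose positions all have count at most
  \<open>k\<close>. In an earlier row, the true cell \<open>j'\<close> of the next row bounds the
  columns by \<open>j'\<close>; up to there the count is at most \<open>i\<close>, so only cell
  \<open>j\<close> is left.\<close>

lemma implied_cell_true:
  assumes "cnt n = k" "{Pos y} \<in> F" "1 \<le> i" "i \<le> k"
    and "1 \<le> j" "j \<le> n - k + 1" "i + j - 1 \<in> N" "cnt (i + j - 1) = i"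
  shows "implied F (Pos (p i j))"
  using assms(4,3,5-8)
proof (induction i arbitrary: j rule: inc_induct)
  case base
  have "cnt (k + l - 1) \<le> k" if "l \<le> n - k + 1" for l
    using cnt_mono[of "k + l - 1" n] that assms(1) k_le by simp
  then show ?case
    using base assms(1,2) k_pos
    by (intro implied_row_true implied_other_cells_false[where j = j]) auto
next
  case (step i)
  obtain j' where j': "1 \<le> j'" "j' \<le> n - k + 1" "i + j' \<in> N" "cnt (i + j') = Suc i"
    using cnt_witness_row[of "Suc i"] step.hyps assms(1) by auto
  have "implied F (Pos (p (Suc i) j'))"
    using j' by (intro step.IH) auto
  have "\<not> i + j' \<le> i + j - 1"
    using cnt_mono[of "i + j'" "i + j - 1"] j' step.prems by auto
  then have "j \<le> j'" by simp
  have others: "implied F (Neg (p i l))" if "1 \<le> l" "l \<le> j'" "l \<noteq> j" for l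
  proof -
    have "i + l - 1 < i + j'" using that by simp
    then have "cnt (i + l - 1) \<le> i"
      using cnt_less[of "i + l - 1" "i + j'"] j' by simp
    then show ?thesis
      using that j'(1,2) step.hyps step.prems assms(1)
      by (intro implied_other_cells_false[where j = j]) auto
  qed
  show ?case
  proof (cases "j' < n - k + 1")
    case True
    show ?thesis
    proof (rule impliedI[OF step_clause[of i j']])
      fix l' assume "l' \<in> {Neg (p (i + 1) j')} \<union> {Pos (p i l) | l. 1 \<le> l \<and> l \<le> j'} - {Pos (p i j)}"
      then consider "l' = Neg (p (Suc i) j')" | l where "l' = Pos (p i l)" "1 \<le> l" "l \<le> j'" "l \<noteq> j"
        by auto
      then show "implied F (complement l')"
        by cases (use others \<open>implied F (Pos (p (Suc i) j'))\<close> in auto)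
    qed (use True j' step.hyps step.prems \<open>j \<le> j'\<close> in auto)
  next
    case False
    \<comment> \<open>Here \<open>j'\<close> is the last column, where no step clause exists; the
      bound \<open>j'\<close> covers the whole row and the row clause takes over.\<close>
    then show ?thesis
      using j' step assms(2) others by (intro implied_row_true) auto
  qed
qed

lemma implied_x:
  assumes "cnt n = k" "{Pos y} \<in> F" "1 \<le> t" "t \<le> n" "t \<in> N"
  shows "implied F (Pos (x t))"
proof -
  define i where "i = cnt t"
  have i: "1 \<le> i" "i \<le> k"
    using cnt_less[of 0 t] cnt_mono[of t n] assms by (auto simp: i_def)
  obtain j where j: "1 \<le> j" "j \<le> n - k + 1" "i + j - 1 \<in> N" "cnt (i + j - 1) = i"
    using cnt_witness_row[OF i assms(1)] .
  then have "i + j - 1 = t"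
    using cnt_inj[of "i + j - 1" t] assms(5) by (simp add: i_def)
  moreover have "implied F (Pos (x (i + j - 1)))"
    using implied_cell_pos implied_cell_true i j assms by blast
  ultimately show ?thesis by simp
qed

end

section \<open>Models of the encoding\<close>

lemma satisfies_card_encodingI:
  assumes "\<And>i. \<lbrakk>1 \<le> i; i \<le> k\<rbrakk>
      \<Longrightarrow> \<exists>l \<in> {Neg y} \<union> {Pos (p i j) | j. 1 \<le> j \<and> j \<le> n - k + 1}. holds v l"
    and "\<And>i j. \<lbrakk>1 \<le> i; i \<le> k; 1 \<le> j; j \<le> n - k + 1\<rbrakk>
      \<Longrightarrow> \<exists>l \<in> {Pos (x (i + j - 1)), Neg (p i j)}. holds v l"
    and "\<And>i j. \<lbrakk>1 \<le> i; i < k; 1 \<le> j; j < n - k + 1\<rbrakk>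
      \<Longrightarrow> \<exists>l \<in> {Neg (p (i + 1) j)} \<union> {Pos (p i l) | l. 1 \<le> l \<and> l \<le> j}. holds v l"
  shows "satisfies v (card_encoding y x p n k)"
  unfolding satisfies_def card_encoding_def
  by (intro ballI, elim UnE CollectE exE conjE; hypsubst; rule assms; assumption)

text \<open>Each clause contains \<open>Neg y\<close> or some negated \<open>p\<close>.\<close>

lemma satisfies_card_encoding_not_y:
  assumes "\<not> v y" "\<And>i j. \<lbrakk>1 \<le> i; i \<le> k; 1 \<le> j; j \<le> n - k + 1\<rbrakk> \<Longrightarrow> \<not> v (p i j)"
  shows "satisfies v (card_encoding y x p n k)"
  by (rule satisfies_card_encodingI) (use assms in auto)

text \<open>The intended meaning of the \<open>p\<close> gives a model: the clauses linking rows
  hold because the \<open>i\<close>-th non-false variable precedes the next one.\<close>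

lemma (in card_propagation) satisfies_card_encoding:
  assumes "cnt n = k"
    and vx: "\<And>t. \<lbrakk>1 \<le> t; t \<le> n; t \<in> N\<rbrakk> \<Longrightarrow> v (x t)"
    and vp: "\<And>i j. \<lbrakk>1 \<le> i; i \<le> k; 1 \<le> j; j \<le> n - k + 1\<rbrakk>
      \<Longrightarrow> v (p i j) \<longleftrightarrow> i + j - 1 \<in> N \<and> cnt (i + j - 1) = i"
  shows "satisfies v (card_encoding y x p n k)"
proof -
  have row: "\<exists>l \<in> {Neg y} \<union> {Pos (p i j) | j. 1 \<le> j \<and> j \<le> n - k + 1}. holds v l"
    if i: "1 \<le> i" "i \<le> k" for i
  proof -
    obtain j where "1 \<le> j" "j \<le> n - k + 1" "i + j - 1 \<in> N" "cnt (i + j - 1) = i"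
      using cnt_witness_row[OF i assms(1)] .
    then show ?thesis using vp[OF i] by force
  qed
  have cell: "\<exists>l \<in> {Pos (x (i + j - 1)), Neg (p i j)}. holds v l"
    if "1 \<le> i" "i \<le> k" "1 \<le> j" "j \<le> n - k + 1" for i j
    using vx[of "i + j - 1"] vp[OF that] that k_le by auto
  have step: "\<exists>l \<in> {Neg (p (i + 1) j)} \<union> {Pos (p i l) | l. 1 \<le> l \<and> l \<le> j}. holds v l"
    if ij: "1 \<le> i" "i < k" "1 \<le> j" "j < n - k + 1" for i j
  proof (cases "v (p (i + 1) j)")
    case True
    then have t: "i + j \<in> N" "cnt (i + j) = i + 1"
      using vp[of "i + 1" j] ij by auto
    obtain l where l: "1 \<le> l" "l \<le> n - k + 1" "i + l - 1 \<in> N" "cnt (i + l - 1) = i"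
      using cnt_witness_row[of i] ij assms(1) by auto
    have "\<not> i + j \<le> i + l - 1"
      using cnt_mono[of "i + j" "i + l - 1"] t l by auto
    then show ?thesis using l vp[of i l] ij by force
  qed simp
  show ?thesis
    using row cell step by (rule satisfies_card_encodingI)
qed

section \<open>Generalized arc consistency\<close>

lemma card_nonfalse:
  "num_false x n \<rho> + card ({t. Neg (x t) \<notin> \<rho>} \<inter> {1..n}) = n"
proof -
  have "{i \<in> {1..n}. Neg (x i) \<in> \<rho>} \<union> ({t. Neg (x t) \<notin> \<rho>} \<inter> {1..n}) = {1..n}" by auto
  moreover have "card ({i \<in> {1..n}. Neg (x i) \<in> \<rho>} \<union> ({t. Neg (x t) \<notin> \<rho>} \<inter> {1..n})) =
      num_false x n \<rho> + card ({t. Neg (x t) \<notin> \<rho>} \<inter> {1..n})"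
    unfolding num_false_def by (rule card_Un_disjoint) auto
  ultimately show ?thesis by simp
qed

lemma satisfies_under:
  "satisfies v (under F \<rho>) \<longleftrightarrow> satisfies v F \<and> (\<forall>l \<in> \<rho>. holds v l)"
  by (auto simp: satisfies_def under_def)

theorem proposition3:
  fixes x :: "nat \<Rightarrow> 'v" and y :: 'v and p :: "nat \<Rightarrow> nat \<Rightarrow> 'v" and n k :: nat
  assumes "1 \<le> k" and "k \<le> n"
    and "inj_on x {1..n}" and "y \<notin> x ` {1..n}"
    and "inj_on (\<lambda>(i, j). p i j) ({1..k} \<times> {1..n - k + 1})"
    and "(\<lambda>(i, j). p i j) ` ({1..k} \<times> {1..n - k + 1}) \<inter> insert y (x ` {1..n}) = {}"
  shows "preserves_gac (card_encoding y x p n k) y x n k"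
  unfolding preserves_gac_def
proof (intro allI impI)
  fix \<rho>
  assume pa: "partial_assignment (x ` {1..n}) \<rho>"
  define E where "E = card_encoding y x p n k"
  define N where "N = {t. Neg (x t) \<notin> \<rho>}"
  have p_fresh: "p i j \<noteq> y" "p i j \<notin> x ` {1..n}"
    if "1 \<le> i" "i \<le> k" "1 \<le> j" "j \<le> n - k + 1" for i j
    using assms(6) that by force+
  have p_eq: "i' = i \<and> j' = j"
    if "p i' j' = p i j" "1 \<le> i" "i \<le> k" "1 \<le> j" "j \<le> n - k + 1"
      "1 \<le> i'" "i' \<le> k" "1 \<le> j'" "j' \<le> n - k + 1" for i j i' j'
    using inj_onD[OF assms(5), of "(i', j')" "(i, j)"] that by auto
  have \<rho>_cases: "(\<exists>t \<in> {1..n}. l = Pos (x t) \<and> Neg (x t) \<notin> \<rho>) \<or>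
      (\<exists>t \<in> {1..n}. l = Neg (x t) \<and> Pos (x t) \<notin> \<rho>)" if "l \<in> \<rho>" for l
    using pa that unfolding partial_assignment_def by fastforce
  interpret U: card_propagation y x p n k N "under E \<rho>"
    using assms(1,2) by unfold_locales (auto simp: E_def N_def under_def)
  interpret Y: card_propagation y x p n k N "under E (\<rho> \<union> {Pos y})"
    using assms(1,2) by unfold_locales (auto simp: E_def N_def under_def)
  have y_unit: "{Pos y} \<in> under E (\<rho> \<union> {Pos y})"
    by (auto simp: under_def)
  have count: "num_false x n \<rho> + U.cnt n = n"
    unfolding U.cnt_def by (simp only: N_def card_nonfalse)

  have conflict: "up_conflict (under E (\<rho> \<union> {Pos y}))" if "num_false x n \<rho> + k > n"
    using Y.conflict_if_y[OF _ y_unit] that count by simp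

  have derives_x: "up_derives (under E (\<rho> \<union> {Pos y})) (Pos (x t))"
    if eq: "num_false x n \<rho> + k = n" and t: "t \<in> {1..n}" "Neg (x t) \<notin> \<rho>" for t
  proof (rule implied_up_derives)
    have cnt: "U.cnt n = k" using eq count by simp
    then show "implied (under E (\<rho> \<union> {Pos y})) (Pos (x t))"
      using t y_unit by (intro Y.implied_x) (auto simp: N_def)
    \<comment> \<open>The intended model: \<open>y\<close>, all non-false variables and one cell per
      row are true. Freshness and injectivity keep these choices from interfering.\<close>
    define v where "v a \<longleftrightarrow> a = y \<or> (\<exists>s \<in> {1..n}. a = x s \<and> s \<in> N) \<or>
      (\<exists>i j. 1 \<le> i \<and> i \<le> k \<and> 1 \<le> j \<and> j \<le> n - k + 1 \<and> a = p i j \<and>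
        i + j - 1 \<in> N \<and> U.cnt (i + j - 1) = i)" for a
    have vx: "v (x s) \<longleftrightarrow> s \<in> N" if "s \<in> {1..n}" for s
    proof -
      have "x s \<noteq> y" using that assms(4) by blast
      moreover have "(\<exists>r \<in> {1..n}. x s = x r \<and> r \<in> N) \<longleftrightarrow> s \<in> N"
        using that inj_onD[OF assms(3)] by blast
      moreover have "x s \<noteq> p i j" if "1 \<le> i" "i \<le> k" "1 \<le> j" "j \<le> n - k + 1" for i j
        using p_fresh(2)[OF that] \<open>s \<in> {1..n}\<close> by (metis imageI)
      ultimately show ?thesis unfolding v_def by meson
    qed
    have vp: "v (p i j) \<longleftrightarrow> i + j - 1 \<in> N \<and> U.cnt (i + j - 1) = i"
      if "1 \<le> i" "i \<le> k" "1 \<le> j" "j \<le> n - k + 1" for i j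
    proof -
      have "\<not> (\<exists>s \<in> {1..n}. p i j = x s \<and> s \<in> N)"
        using p_fresh(2)[OF that] by blast
      then show ?thesis
        using p_fresh(1)[OF that] p_eq[OF _ that] that unfolding v_def by metis
    qed
    have "satisfies v E"
      unfolding E_def using cnt vx vp by (intro U.satisfies_card_encoding) auto
    moreover have "holds v l" if "l \<in> \<rho>" for l
      using \<rho>_cases[OF that] vx that by (auto simp: N_def)
    moreover have "v y" by (simp add: v_def)
    ultimately have "satisfies v (under E (\<rho> \<union> {Pos y}))"
      by (auto simp: satisfies_under)
    then show "\<not> up_conflict (under E (\<rho> \<union> {Pos y}))" by (rule satisfies_no_conflict)
  qed

  have derives_not_y: "up_derives (under E \<rho>) (Neg y)" if "num_false x n \<rho> + k > n"
  proof (rule implied_up_derives)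
    show "implied (under E \<rho>) (Neg y)"
      using that count by (intro U.implied_not_y) simp
    \<comment> \<open>Making only the positive literals of \<open>\<rho>\<close> true leaves
      \<open>y\<close> and all cells false.\<close>
    define v where "v a \<longleftrightarrow> Pos a \<in> \<rho>" for a
    have v: "a \<in> x ` {1..n}" if "v a" for a
      using \<rho>_cases[of "Pos a"] that by (auto simp: v_def)
    then have "satisfies v E"
      unfolding E_def using assms(4) p_fresh(2) by (intro satisfies_card_encoding_not_y) blast+
    moreover have "holds v l" if "l \<in> \<rho>" for l
      using \<rho>_cases[OF that] that by (auto simp: v_def)
    ultimately show "\<not> up_conflict (under E \<rho>)"
      by (intro satisfies_no_conflict[of v]) (simp add: satisfies_under)
  qed

  show "(num_false x n \<rho> + k > n \<longrightarrow>
        up_conflict (under (card_encoding y x p n k) (\<rho> \<union> {Pos y}))) \<and>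
      (num_false x n \<rho> + k = n \<longrightarrow>
        (\<forall>j \<in> {1..n}. Pos (x j) \<notin> \<rho> \<and> Neg (x j) \<notin> \<rho> \<longrightarrow>
          up_derives (under (card_encoding y x p n k) (\<rho> \<union> {Pos y})) (Pos (x j)))) \<and>
      (num_false x n \<rho> + k > n \<longrightarrow>
        up_derives (under (card_encoding y x p n k) \<rho>) (Neg y))"
    using conflict derives_x derives_not_y unfolding E_def by blast
qed

end
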